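(* Let $n\ge 1$. There are no proper semisimple decompositions of the matrix algebra $M_n(\mathbb{C})$; that is, there are no proper subalgebras $A_1,A_2$ of $A=M_n(\mathbb{C})$, both semisimple, such that $A=A_1+A_2$ as a sum of vector subspaces.
   Context: Algebras are finite-dimensional associative algebras over $\mathbb{C}$; subalgebras are not required to contain the unit of $A$. A decomposition of an algebra $A$ is a triple $(A,A_1,A_2)$ where $A_1,A_2$ are subalgebras of $A$ and $A=A_1+A_2$ is a (not necessarily direct) vector space sum. It is proper if $A_1,A_2$ are proper subalgebras of $A$, and semisimple if $A,A_1,A_2$ are all semisimple (zero Jacobson radical). *)

theory Defs
  imports "HOL-Analysis.Analysis"
begin

text \<open>
  \<open>M\<^sub>n(\<complex>)\<close> is the type \<^typ>\<open>complex^'n^'n\<close> with product \<open>**\<close>, where \<open>n = CARD('n) \<ge> 1\<close>.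
  The library provides only the real scalar action on this type, so the complex one is
  introduced here.
\<close>

definition cmat_scale :: "complex \<Rightarrow> complex^'n^'n \<Rightarrow> complex^'n^'n" where
  "cmat_scale c M = (\<chi> i j. c * M $ i $ j)"

global_interpretation cmat: vector_space "cmat_scale :: complex \<Rightarrow> complex^'n^'n \<Rightarrow> complex^'n^'n"
  by unfold_locales (simp_all add: cmat_scale_def vec_eq_iff algebra_simps)

text \<open>Subalgebras are not required to contain the identity matrix.\<close>

definition subalgebra :: "(complex^'n^'n) set \<Rightarrow> bool" where
  "subalgebra A \<longleftrightarrow> cmat.subspace A \<and> (\<forall>x\<in>A. \<forall>y\<in>A. x ** y \<in> A)"

definition left_ideal :: "(complex^'n^'n) set \<Rightarrow> (complex^'n^'n) set \<Rightarrow> bool" where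
  "left_ideal A L \<longleftrightarrow> cmat.subspace L \<and> L \<subseteq> A \<and> (\<forall>a\<in>A. \<forall>x\<in>L. a ** x \<in> L)"

text \<open>
  The Jacobson radical of a possibly non-unital algebra is the intersection of its maximal
  modular left ideals, where \<open>L\<close> is modular if \<open>A\<close> has a right unit modulo \<open>L\<close>.
  If \<open>A\<close> has a unit, every left ideal is modular. If there are no maximal modular left ideals,
  the intersection is \<open>A\<close> itself; thus the zero algebra is semisimple, and a nonzero algebra
  with zero product is not.
\<close>

definition modular_left_ideal :: "(complex^'n^'n) set \<Rightarrow> (complex^'n^'n) set \<Rightarrow> bool" where
  "modular_left_ideal A L \<longleftrightarrow> left_ideal A L \<and> (\<exists>e\<in>A. \<forall>a\<in>A. a - a ** e \<in> L)"

definition maximal_modular_left_ideal :: "(complex^'n^'n) set \<Rightarrow> (complex^'n^'n) set \<Rightarrow> bool" where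
  "maximal_modular_left_ideal A L \<longleftrightarrow> modular_left_ideal A L \<and> L \<noteq> A \<and>
     (\<forall>L'. left_ideal A L' \<and> L \<subseteq> L' \<longrightarrow> L' = L \<or> L' = A)"

definition jacobson_radical :: "(complex^'n^'n) set \<Rightarrow> (complex^'n^'n) set" where
  "jacobson_radical A = {x \<in> A. \<forall>L. maximal_modular_left_ideal A L \<longrightarrow> x \<in> L}"

definition semisimple :: "(complex^'n^'n) set \<Rightarrow> bool" where
  "semisimple A \<longleftrightarrow> jacobson_radical A = {0}"

end

theory Submission
  imports Defs "HOL-Computational_Algebra.Fundamental_Theorem_Algebra"
begin

text \<open>
  A nonzero semisimple proper subalgebra \<open>A\<close> commutes with some idempotent matrix \<open>p \<noteq> 0, 1\<close>.
  Indeed, a minimal left ideal of \<open>A\<close> is generated by an idempotent \<open>e\<close> with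
  \<open>e A e = \<complex> e\<close>, and the pairing \<open>e A \<times> A e \<longrightarrow> \<complex> e\<close>, \<open>(y, x) \<mapsto> y x\<close>, is nondegenerate.
  Take dual bases \<open>y\<^sub>i x\<^sub>j = \<delta>\<^sub>i\<^sub>j e\<close> and a rank one idempotent \<open>\<pi> = e \<pi> e\<close>; then
  \<open>p = \<Sum>\<^sub>i x\<^sub>i \<pi> y\<^sub>i\<close> is a nonzero idempotent commuting with \<open>A\<close>, and \<open>p = 1\<close> would make
  \<open>A\<close> the full matrix algebra.

  It remains to see that the centralizers of two idempotents \<open>p, q \<noteq> 0, 1\<close> do not span
  \<open>M\<^sub>n(\<complex>)\<close>. The orthogonal complement of the centralizer of \<open>p\<close> in the trace form consists of
  the \<open>z\<close> with \<open>p z + z p = z\<close>. If \<open>p\<close> and \<open>q\<close> do not commute, then \<open>z = p q - q p\<close> lies in both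
  complements; otherwise \<open>p q x (1 - p) (1 - q)\<close> and \<open>p (1 - q) x (1 - p) q\<close> do, and one of them
  is nonzero for some \<open>x\<close>.
\<close>

section \<open>Matrix arithmetic\<close>

lemma matrix_mul_zero [simp]:
  fixes x :: "complex^'n^'n"
  shows "0 ** x = 0" "x ** 0 = 0"
  by (simp_all add: matrix_matrix_mult_def vec_eq_iff)

lemma cmat_scale_mult:
  fixes x y :: "complex^'n^'n"
  shows "cmat_scale c x ** y = cmat_scale c (x ** y)"
    and "x ** cmat_scale c y = cmat_scale c (x ** y)"
  by (simp_all add: cmat_scale_def matrix_matrix_mult_def vec_eq_iff sum_distrib_left algebra_simps)

lemma cmat_scale_mult_vector:
  fixes x :: "complex^'n^'n"
  shows "cmat_scale c x *v v = c *s (x *v v)"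
  by (simp add: cmat_scale_def matrix_vector_mult_def vec_eq_iff sum_distrib_left algebra_simps)

lemma matrix_add_rdistrib:
  fixes x y z :: "complex^'n^'n"
  shows "(x + y) ** z = x ** z + y ** z"
  by (simp add: matrix_matrix_mult_def vec_eq_iff sum.distrib algebra_simps)

lemma matrix_diff_distrib:
  fixes x y z :: "complex^'n^'n"
  shows "(x - y) ** z = x ** z - y ** z" and "z ** (x - y) = z ** x - z ** y"
  by (simp_all add: matrix_matrix_mult_def vec_eq_iff sum_subtractf algebra_simps)

lemma matrix_sum_distrib:
  fixes z :: "complex^'n^'n" and x :: "'i \<Rightarrow> complex^'n^'n"
  shows "sum x I ** z = (\<Sum>i\<in>I. x i ** z)" and "z ** sum x I = (\<Sum>i\<in>I. z ** x i)"
  by (induction I rule: infinite_finite_induct)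
    (simp_all add: matrix_add_ldistrib matrix_add_rdistrib)

lemma matrix_nonzero_imp_vector:
  fixes x :: "complex^'n^'n"
  assumes "x \<noteq> 0"
  obtains v where "x *v v \<noteq> 0"
  using assms by (metis matrix_eq matrix_vector_mult_0)

text \<open>Gives access to real dimension, which selects a minimal left ideal and bounds the length
  of dual systems.\<close>

lemma cmat_subspace_imp_subspace:
  fixes L :: "(complex^'n^'n) set"
  assumes "cmat.subspace L"
  shows "subspace L"
proof -
  have "r *\<^sub>R x = cmat_scale (complex_of_real r) x" for r and x :: "complex^'n^'n"
    unfolding cmat_scale_def vec_eq_iff vector_scaleR_component vec_lambda_beta
    by (simp only: scaleR_conv_of_real) simp
  then show ?thesis
    using assms by (simp add: cmat.subspace_def subspace_def)
qed

section \<open>Elementary matrices, primeness and the trace form\<close>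

definition elementary_matrix :: "'n \<Rightarrow> 'n \<Rightarrow> complex^'n^'n" where
  "elementary_matrix i j = (\<chi> k l. if k = i \<and> l = j then 1 else 0)"

text \<open>The product is the outer product of column \<open>i\<close> of \<open>x\<close> and row
  \<open>j\<close> of \<open>y\<close>.\<close>

lemma mult_elementary_mult:
  "(x ** elementary_matrix i j ** y) $ k $ l = x $ k $ i * y $ j $ l"
proof -
  have "(x ** elementary_matrix i j) $ k $ m = (if m = j then x $ k $ i else 0)" for m
    by (cases "m = j") (simp_all add: elementary_matrix_def matrix_matrix_mult_def if_distrib cong: if_cong)
  then show ?thesis
    by (simp add: matrix_matrix_mult_def[of _ y] if_distrib[of "\<lambda>a. a * _"] cong: if_cong)
qed

lemma matrix_algebra_prime:
  fixes a b :: "complex^'n^'n"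
  assumes "a \<noteq> 0" "b \<noteq> 0"
  obtains x where "a ** x ** b \<noteq> 0"
proof -
  obtain i j k l where ij: "a $ i $ j \<noteq> 0" and kl: "b $ k $ l \<noteq> 0"
    using assms by (auto simp: vec_eq_iff)
  then have "(a ** elementary_matrix j k ** b) $ i $ l \<noteq> 0"
    by (simp add: mult_elementary_mult)
  then show ?thesis
    by (metis that zero_index)
qed

lemma trace_form_nondegenerate:
  fixes z :: "complex^'n^'n"
  assumes "\<And>x. trace (x ** z) = 0"
  shows "z = 0"
proof -
  have "z $ j $ i = 0" for i j
  proof -
    have "(elementary_matrix i j ** z) $ k $ k = (if k = i then z $ j $ i else 0)" for k
      \<comment> \<open>The left factor \<open>mat 1\<close> brings the product into sandwich
        form.\<close>
      using mult_elementary_mult[of "mat 1" i j z k k]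
      unfolding matrix_mul_lid by (simp add: mat_def)
    then have "trace (elementary_matrix i j ** z) = z $ j $ i"
      by (simp add: trace_def)
    then show ?thesis
      using assms by simp
  qed
  then show ?thesis
    by (simp add: vec_eq_iff)
qed

section \<open>Sums of centralizers of idempotents\<close>

text \<open>In blocks with respect to \<open>p\<close>, \<open>x\<close> is diagonal and
  \<open>z\<close> off-diagonal, so \<open>x ** z\<close> has zero diagonal blocks. Formally,
  \<open>p ** z ** p = 0\<close> and cyclicity of the trace show that \<open>x ** p ** z\<close> and
  \<open>x ** z ** p\<close> have trace zero.\<close>

lemma trace_centralizer_eq_0:
  fixes p x z :: "complex^'n^'n"
  assumes p: "p ** p = p" and xp: "x ** p = p ** x" and z: "p ** z + z ** p = z"
  shows "trace (x ** z) = 0"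
proof -
  have "p ** (p ** z + z ** p) = p ** z"
    by (simp add: z)
  then have pzp: "p ** z ** p = 0"
    by (simp add: matrix_add_ldistrib matrix_mul_assoc p)
  have "x ** p ** z = p ** x ** p ** z"
    by (metis matrix_mul_assoc p xp)
  then have "trace (x ** p ** z) = trace (p ** (x ** p ** z))"
    by (metis matrix_mul_assoc)
  also have "\<dots> = trace (x ** (p ** z ** p))"
    by (subst trace_mul_sym) (simp add: matrix_mul_assoc)
  finally have 1: "trace (x ** p ** z) = 0"
    by (simp add: pzp trace_def)
  have "trace (x ** z ** p) = trace (p ** (x ** z))"
    by (rule trace_mul_sym)
  also have "\<dots> = trace (x ** p ** z)"
    by (simp add: xp matrix_mul_assoc)
  finally have "trace (x ** (p ** z + z ** p)) = 0"
    by (simp add: matrix_add_ldistrib trace_add matrix_mul_assoc 1)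
  then show ?thesis
    by (simp add: z)
qed

lemma common_off_diagonal:
  fixes p q :: "complex^'n^'n"
  assumes p: "p ** p = p" "p \<noteq> 0" "p \<noteq> mat 1"
    and q: "q ** q = q" "q \<noteq> 0" "q \<noteq> mat 1"
  obtains z where "z \<noteq> 0" "p ** z + z ** p = z" "q ** z + z ** q = z"
proof (cases "p ** q = q ** p")
  case False
  \<comment> \<open>Products are normalized by associating to the left, so the rewrite rules need a
    prefix \<open>y\<close>.\<close>
  have pq: "y ** p ** p = y ** p" "y ** q ** q = y ** q" for y :: "complex^'n^'n"
    by (metis matrix_mul_assoc p(1) q(1))+
  show ?thesis
    by (rule that[of "p ** q - q ** p"])
      (use False in \<open>simp_all add: matrix_diff_distrib matrix_mul_assoc p(1) q(1) pq\<close>)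
next
  case comm: True
  have pq: "y ** p ** p = y ** p" "y ** q ** q = y ** q" "y ** q ** p = y ** p ** q" for y :: "complex^'n^'n"
    by (metis matrix_mul_assoc p(1) q(1) comm)+
  note simps = matrix_diff_distrib matrix_mul_assoc p(1) q(1) pq comm[symmetric]
  define p' q' where "p' = mat 1 - p" and "q' = mat 1 - q"
  have nz: "p' \<noteq> 0" "q' \<noteq> 0"
    using p q by (auto simp: p'_def q'_def)
  \<comment> \<open>Each of \<open>p\<close>, \<open>q\<close>, \<open>p'\<close>, \<open>q'\<close>
    is a sum of two of the four products. Hence if \<open>p ** q\<close> or \<open>p' ** q'\<close>
    vanishes, both mixed products are nonzero.\<close>
  have "p ** q + p ** q' = p" "p ** q + p' ** q = q"
    "p ** q' + p' ** q' = q'" "p' ** q + p' ** q' = p'"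
    by (simp_all add: p'_def q'_def matrix_diff_distrib)
  then consider "p ** q \<noteq> 0" "p' ** q' \<noteq> 0" | "p ** q' \<noteq> 0" "p' ** q \<noteq> 0"
    using nz p q by fastforce
  then show ?thesis
  proof cases
    case 1
    then obtain x where "p ** q ** x ** (p' ** q') \<noteq> 0"
      by (rule matrix_algebra_prime)
    then show ?thesis
      by (rule that) (simp_all add: p'_def q'_def simps)
  next
    \<comment> \<open>Here \<open>p\<close> and \<open>q\<close> act on opposite sides of the
      product \<open>z\<close>: \<open>p ** z = z\<close> and \<open>z ** p = 0\<close>, but
      \<open>q ** z = 0\<close> and \<open>z ** q = z\<close>.\<close>
    case 2
    then obtain x where "p ** q' ** x ** (p' ** q) \<noteq> 0"
      by (rule matrix_algebra_prime)
    then show ?thesis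
      by (rule that) (simp_all add: p'_def q'_def simps)
  qed
qed

section \<open>Eigenvectors inside an invariant subspace\<close>

text \<open>Horner evaluation of the polynomial \<open>P\<close> at \<open>b\<close>, applied to
  \<open>v\<close>.\<close>

definition poly_act :: "complex^'n^'n \<Rightarrow> complex poly \<Rightarrow> complex^'n \<Rightarrow> complex^'n" where
  "poly_act b P v = fold_coeffs (\<lambda>c w. c *s v + b *v w) P 0"

lemma poly_act_0 [simp]: "poly_act b 0 v = 0"
  by (simp add: poly_act_def)

lemma poly_act_pCons [simp]: "poly_act b (pCons c P) v = c *s v + b *v poly_act b P v"
  by (cases "c = 0 \<and> P = 0") (auto simp: poly_act_def)

lemma poly_act_add: "poly_act b (P + Q) v = poly_act b P v + poly_act b Q v"
  by (induction P Q rule: poly_induct2)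
    (simp_all add: vec.scale_left_distrib matrix_vector_right_distrib algebra_simps)

lemma poly_act_smult: "poly_act b (smult c P) v = c *s poly_act b P v"
  by (induction P) (simp_all add: vec.scale_right_distrib vec.scale)

lemma poly_act_monom: "poly_act b (monom c i) v = c *s (((*v) b ^^ i) v)"
  by (induction i) (simp_all add: monom_0 monom_Suc vec.scale)

lemma poly_act_sum: "poly_act b (sum P I) v = (\<Sum>i\<in>I. poly_act b (P i) v)"
  by (induction I rule: infinite_finite_induct) (simp_all add: poly_act_add)

lemma poly_act_closed:
  assumes "vec.subspace U" "\<And>u. u \<in> U \<Longrightarrow> b *v u \<in> U" "v \<in> U"
  shows "poly_act b P v \<in> U"
  by (induction P) (use assms in \<open>simp_all add: vec.subspace_0 vec.subspace_add vec.subspace_scale\<close>)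

text \<open>The iterates of \<open>b\<close> on \<open>v\<close> with exponents 0 to
  \<open>CARD('n)\<close> are one too many to be independent.\<close>

lemma exists_annihilating_poly:
  fixes b :: "complex^'n^'n"
  obtains P where "P \<noteq> 0" "poly_act b P v = 0"
proof -
  define w where "w i = ((*v) b ^^ i) v" for i
  let ?I = "{..CARD('n)}"
  show thesis
  \<comment> \<open>Dependence concerns the set of iterates, so a repetition is treated apart, by
    the polynomial \<open>X^i - X^j\<close>.\<close>
  proof (cases "inj_on w ?I")
    case False
    then obtain i j where ij: "i \<noteq> j" "w i = w j"
      by (auto simp: inj_on_def)
    show thesis
    proof (rule that)
      have "coeff (monom 1 i + monom (-1) j :: complex poly) i \<noteq> 0"
        using ij by simp
      then show "monom 1 i + monom (-1) j \<noteq> (0 :: complex poly)"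
        by (metis coeff_0)
      show "poly_act b (monom 1 i + monom (-1) j) v = 0"
        using ij by (simp add: poly_act_add poly_act_monom w_def)
    qed
  next
    case True
    have "vec.dependent (w ` ?I)"
    proof (rule ccontr)
      assume "\<not> vec.dependent (w ` ?I)"
      then have "card (w ` ?I) \<le> vec.dim (UNIV :: (complex^'n) set)"
        by (intro vec.independent_card_le_dim) auto
      then show False
        by (simp add: card_image True vec.dim_UNIV card_cart_basis)
    qed
    then obtain c i where i: "i \<in> ?I" "c (w i) \<noteq> 0" and "(\<Sum>x\<in>w ` ?I. c x *s x) = 0"
      by (auto simp: vec.dependent_finite)
    then have "(\<Sum>i\<in>?I. c (w i) *s w i) = 0"
      by (simp add: sum.reindex True)
    then have "poly_act b (\<Sum>i\<in>?I. monom (c (w i)) i) v = 0"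
      by (simp add: poly_act_sum poly_act_monom w_def)
    moreover have "coeff (\<Sum>i\<in>?I. monom (c (w i)) i) i \<noteq> 0"
      using i by (simp add: coeff_sum)
    ultimately show thesis
      by (metis that coeff_0)
  qed
qed

text \<open>Split off a root, \<open>P = (X - c) Q\<close>: either \<open>Q\<close> still
  annihilates \<open>v\<close> and has smaller degree, or \<open>Q(b) v\<close> is an eigenvector
  for \<open>c\<close>, and it lies in \<open>U\<close> by invariance.\<close>

lemma eigenvector_of_annihilating_poly:
  fixes b :: "complex^'n^'n"
  assumes "vec.subspace U" "\<And>u. u \<in> U \<Longrightarrow> b *v u \<in> U" "v \<in> U" "v \<noteq> 0"
    and "P \<noteq> 0" "poly_act b P v = 0"
  shows "\<exists>c w. w \<in> U \<and> w \<noteq> 0 \<and> b *v w = c *s w"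
  using assms(5,6)
proof (induction "degree P" arbitrary: P)
  case 0
  then obtain c where "P = [:c:]"
    by (metis degree_0_id)
  then show ?case
    using 0 assms(4) by simp
next
  case (Suc n)
  obtain c where "poly P c = 0"
    using fundamental_theorem_of_algebra_alt[of P] Suc.hyps(2) by force
  then obtain Q where Q: "P = [:-c, 1:] * Q"
    by (meson poly_eq_0_iff_dvd dvdE)
  have "Q \<noteq> 0"
    using Q Suc.prems by auto
  have "degree Q = n"
    using Suc.hyps(2) \<open>Q \<noteq> 0\<close> unfolding Q by (subst (asm) degree_mult_eq) auto
  have "P = smult (-c) Q + pCons 0 Q"
    by (simp add: Q)
  then have eig: "b *v poly_act b Q v = c *s poly_act b Q v"
    using Suc.prems(2) by (simp only: poly_act_add poly_act_smult poly_act_pCons) simp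
  show ?case
  proof (cases "poly_act b Q v = 0")
    case True
    then show ?thesis
      using Suc.hyps(1)[of Q] \<open>degree Q = n\<close> \<open>Q \<noteq> 0\<close> by simp
  next
    case False
    then show ?thesis
      using eig poly_act_closed[OF assms(1-3)] by blast
  qed
qed

lemma exists_eigenvector:
  fixes b :: "complex^'n^'n"
  assumes "vec.subspace U" "\<And>u. u \<in> U \<Longrightarrow> b *v u \<in> U" "v \<in> U" "v \<noteq> 0"
  obtains c w where "w \<in> U" "w \<noteq> 0" "b *v w = c *s w"
  using exists_annihilating_poly[of b v] eigenvector_of_annihilating_poly[OF assms] by metis

section \<open>Left ideals of semisimple algebras\<close>

lemma subalgebra_left_ideal: "subalgebra A \<Longrightarrow> left_ideal A A"
  by (simp add: subalgebra_def left_ideal_def)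

lemma left_ideal_mult_right:
  assumes L: "left_ideal A L" and N: "left_ideal A N" and x: "x \<in> L"
  shows "left_ideal A ((\<lambda>y. y ** x) ` N)" and "(\<lambda>y. y ** x) ` N \<subseteq> L"
proof -
  have N': "cmat.subspace N" "N \<subseteq> A" and Nm: "\<And>a y. a \<in> A \<Longrightarrow> y \<in> N \<Longrightarrow> a ** y \<in> N"
    using N by (auto simp: left_ideal_def)
  show sub: "(\<lambda>y. y ** x) ` N \<subseteq> L"
    using L x N'(2) by (auto simp: left_ideal_def)
  have "cmat.subspace ((\<lambda>y. y ** x) ` N)"
    unfolding cmat.subspace_def
  proof (intro conjI ballI allI)
    show "0 \<in> (\<lambda>y. y ** x) ` N"
      using cmat.subspace_0[OF N'(1)] by (metis image_eqI matrix_mul_zero(1))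
    show "u + v \<in> (\<lambda>y. y ** x) ` N" if "u \<in> (\<lambda>y. y ** x) ` N" "v \<in> (\<lambda>y. y ** x) ` N" for u v
      using that cmat.subspace_add[OF N'(1)] by (auto simp flip: matrix_add_rdistrib)
    show "cmat_scale c u \<in> (\<lambda>y. y ** x) ` N" if "u \<in> (\<lambda>y. y ** x) ` N" for c u
      using that cmat.subspace_scale[OF N'(1)] by (auto simp flip: cmat_scale_mult)
  qed
  then show "left_ideal A ((\<lambda>y. y ** x) ` N)"
    using L sub Nm by (auto simp: left_ideal_def matrix_mul_assoc)
qed

text \<open>If a maximal modular \<open>L\<close> did not contain \<open>N\<close>, then
  \<open>L + N = A\<close>, so the modular unit is \<open>e = l + n\<close>. As
  \<open>n ** n = 0\<close>, \<open>n = (n - n ** e) + n ** l\<close> lies in \<open>L\<close>,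
  hence so do \<open>e\<close> and every \<open>a = (a - a ** e) + a ** e\<close>. So
  \<open>N\<close> lies in the radical.\<close>

lemma square_zero_left_ideal_trivial:
  assumes sub: "subalgebra A" and A: "semisimple A" and N: "left_ideal A N"
    and sq: "\<And>x y. x \<in> N \<Longrightarrow> y \<in> N \<Longrightarrow> x ** y = 0"
  shows "N \<subseteq> {0}"
proof -
  have As: "cmat.subspace A"
    using sub by (simp add: subalgebra_def)
  have Ns: "cmat.subspace N" "N \<subseteq> A" and Nm: "\<And>a x. a \<in> A \<Longrightarrow> x \<in> N \<Longrightarrow> a ** x \<in> N"
    using N by (auto simp: left_ideal_def)
  have "N \<subseteq> L" if L: "maximal_modular_left_ideal A L" for L
  proof (rule ccontr)
    assume nsub: "\<not> N \<subseteq> L"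
    have Ls: "cmat.subspace L" "L \<subseteq> A" and Lm: "\<And>a x. a \<in> A \<Longrightarrow> x \<in> L \<Longrightarrow> a ** x \<in> L"
      and max: "\<And>L'. left_ideal A L' \<Longrightarrow> L \<subseteq> L' \<Longrightarrow> L' = L \<or> L' = A" and "L \<noteq> A"
      using L by (auto simp: maximal_modular_left_ideal_def modular_left_ideal_def left_ideal_def)
    obtain e where e: "e \<in> A" "\<And>a. a \<in> A \<Longrightarrow> a - a ** e \<in> L"
      using L by (auto simp: maximal_modular_left_ideal_def modular_left_ideal_def)
    let ?S = "{l + x | l x. l \<in> L \<and> x \<in> N}"
    have 0: "0 \<in> L" "0 \<in> N"
      using Ls Ns by (simp_all add: cmat.subspace_0)
    have "left_ideal A ?S"
      unfolding left_ideal_def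
    proof (intro conjI ballI)
      show "cmat.subspace ?S"
        by (rule cmat.subspace_sums[OF Ls(1) Ns(1)])
      show "?S \<subseteq> A"
        using Ls Ns cmat.subspace_add[OF As] by blast
      show "a ** x \<in> ?S" if "a \<in> A" "x \<in> ?S" for a x
        using that Lm Nm matrix_add_ldistrib[of a] by blast
    qed
    moreover have "L \<subseteq> ?S"
      using 0 by force
    moreover have "?S \<noteq> L"
      using nsub 0 by force
    ultimately have "?S = A"
      using max by blast
    then obtain l n where ln: "l \<in> L" "n \<in> N" "e = l + n"
      using e(1) by blast
    have "n \<in> A"
      using ln(2) Ns by blast
    have "n ** e = n ** l"
      by (simp add: ln matrix_add_ldistrib sq)
    then have "(n - n ** e) + n ** l = n"
      by simp
    then have "n \<in> L"
      using e(2)[OF \<open>n \<in> A\<close>] Lm[OF \<open>n \<in> A\<close> ln(1)] cmat.subspace_add[OF Ls(1)] by metis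
    then have "e \<in> L"
      using ln cmat.subspace_add[OF Ls(1)] by simp
    have "a \<in> L" if "a \<in> A" for a
      using cmat.subspace_add[OF Ls(1) e(2)[OF that] Lm[OF that \<open>e \<in> L\<close>]] by simp
    then show False
      using Ls \<open>L \<noteq> A\<close> by blast
  qed
  then have "N \<subseteq> jacobson_radical A"
    using Ns by (auto simp: jacobson_radical_def)
  then show ?thesis
    using A by (simp add: semisimple_def)
qed

section \<open>A primitive idempotent\<close>

text \<open>\<open>square_zero\<close> carries all that the later arguments use of
  semisimplicity.\<close>

locale primitive_idempotent =
  fixes A :: "(complex^'n^'n) set" and e :: "complex^'n^'n"
  assumes subalgebra: "subalgebra A"
    and square_zero: "left_ideal A N \<Longrightarrow> (\<And>x y. x \<in> N \<Longrightarrow> y \<in> N \<Longrightarrow> x ** y = 0) \<Longrightarrow> N \<subseteq> {0}"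
    and e_in: "e \<in> A" and e_nz: "e \<noteq> 0" and e_idem: "e ** e = e"
    and corner: "a \<in> A \<Longrightarrow> \<exists>c. e ** a ** e = cmat_scale c e"

text \<open>Brauer's lemma for a minimal left ideal \<open>L\<close>: it contains \<open>x\<close>
  with \<open>L x = L\<close>, and \<open>e ** x = x\<close> determines the idempotent. An
  eigenvalue of \<open>e ** a ** e\<close> then takes the role of Schur's lemma.\<close>

lemma semisimple_imp_primitive_idempotent:
  fixes A :: "(complex^'n^'n) set"
  assumes sub: "subalgebra A" and ss: "semisimple A" and "A \<noteq> {0}"
  obtains e where "primitive_idempotent A e"
proof -
  have "left_ideal A A \<and> A \<noteq> {0}"
    using assms by (simp add: subalgebra_left_ideal)
  then obtain L where L: "left_ideal A L" "L \<noteq> {0}"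
    and least: "\<And>L'. left_ideal A L' \<Longrightarrow> L' \<noteq> {0} \<Longrightarrow> dim L \<le> dim L'"
    using ex_has_least_nat[of "\<lambda>L. left_ideal A L \<and> L \<noteq> {0}" A dim] by blast
  have min: "L' = L" if L': "left_ideal A L'" "L' \<subseteq> L" "L' \<noteq> {0}" for L'
  proof (rule subspace_dim_equal)
    show "subspace L'" "subspace L"
      using L(1) L'(1) by (auto simp: left_ideal_def intro: cmat_subspace_imp_subspace)
  qed (use least L' in auto)
  have Ls: "cmat.subspace L" "L \<subseteq> A" and Lm: "\<And>a x. a \<in> A \<Longrightarrow> x \<in> L \<Longrightarrow> a ** x \<in> L"
    using L(1) by (auto simp: left_ideal_def)
  obtain x y where xy: "x \<in> L" "y \<in> L" "y ** x \<noteq> 0"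
    using square_zero_left_ideal_trivial[OF sub ss L(1)] L(2) cmat.subspace_0[OF Ls(1)] by blast
  have "(\<lambda>y. y ** x) ` L = L"
    using left_ideal_mult_right[OF L(1) L(1) xy(1)] xy by (intro min) auto
  then obtain e where e: "e \<in> L" "e ** x = x"
    using xy(1) by (metis imageE)
  have "e \<noteq> 0"
    using e xy by auto
  \<comment> \<open>The annihilator of \<open>x\<close> in \<open>L\<close> misses \<open>y\<close>,
    so minimality makes it zero; it contains \<open>e ** e - e\<close> because
    \<open>e ** x = x\<close>.\<close>
  let ?K = "{y \<in> L. y ** x = 0}"
  have "left_ideal A ?K"
    unfolding left_ideal_def
  proof (intro conjI ballI)
    show "cmat.subspace ?K"
      using Ls(1) by (auto simp: cmat.subspace_def matrix_add_rdistrib cmat_scale_mult)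
    show "a ** y \<in> ?K" if "a \<in> A" "y \<in> ?K" for a y
      using that Lm by (simp flip: matrix_mul_assoc)
  qed (use Ls in auto)
  then have "?K = {0}"
    using min[of ?K] xy by blast
  moreover have "e ** e - e \<in> ?K"
    using e Ls Lm by (auto simp: matrix_diff_distrib cmat.subspace_diff simp flip: matrix_mul_assoc)
  ultimately have ee: "e ** e = e"
    by auto
  have "\<exists>c. e ** a ** e = cmat_scale c e" if "a \<in> A" for a
  proof -
    let ?b = "e ** a ** e"
    \<comment> \<open>The range of \<open>e\<close>, as \<open>e\<close> is idempotent.\<close>
    let ?U = "{u. e *v u = u}"
    obtain v where v: "e *v v \<noteq> 0"
      using \<open>e \<noteq> 0\<close> by (rule matrix_nonzero_imp_vector)
    obtain c w where w: "w \<in> ?U" "w \<noteq> 0" "?b *v w = c *s w"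
    proof (rule exists_eigenvector[of ?U ?b "e *v v"])
      show "vec.subspace ?U"
        by (auto simp: vec.subspace_def matrix_vector_right_distrib vec.scale)
    qed (use v in \<open>auto simp: matrix_vector_mul_assoc matrix_mul_assoc ee\<close>)
    \<comment> \<open>\<open>d\<close> kills \<open>w\<close>. If \<open>d \<noteq> 0\<close>, then
      \<open>A d = L\<close> contains \<open>e\<close>, so \<open>e\<close> kills \<open>w\<close>
      as well, against \<open>e *v w = w\<close>.\<close>
    define d where "d = ?b - cmat_scale c e"
    have dw: "d *v w = 0"
      using w by (simp add: d_def matrix_vector_mult_diff_rdistrib cmat_scale_mult_vector)
    have "d \<in> L"
      using that e Ls Lm by (auto simp: d_def cmat.subspace_diff cmat.subspace_scale simp flip: matrix_mul_assoc)
    have "d = 0"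
    proof (rule ccontr)
      assume "d \<noteq> 0"
      have "e ** d = d"
        by (simp add: d_def matrix_diff_distrib cmat_scale_mult matrix_mul_assoc ee)
      then have "d \<in> (\<lambda>a. a ** d) ` A"
        using e Ls by (metis image_eqI subsetD)
      then have "(\<lambda>a. a ** d) ` A = L"
        using left_ideal_mult_right[OF L(1) subalgebra_left_ideal[OF sub] \<open>d \<in> L\<close>] \<open>d \<noteq> 0\<close>
        by (intro min) auto
      then obtain a' where "e = a' ** d"
        using e by blast
      then have "e *v w = 0"
        by (simp add: dw flip: matrix_vector_mul_assoc)
      then show False
        using w by simp
    qed
    then show ?thesis
      by (auto simp: d_def)
  qed
  moreover have "e \<in> A"
    using e Ls by blast
  ultimately have "primitive_idempotent A e"
    using sub square_zero_left_ideal_trivial[OF sub ss] \<open>e \<noteq> 0\<close> ee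
    by unfold_locales auto
  then show thesis
    by (rule that)
qed

section \<open>The pairing between \<open>e A\<close> and \<open>A e\<close>, and the commuting
  idempotent\<close>

context primitive_idempotent
begin

lemma subspace_A: "cmat.subspace A"
  and mult_in: "x \<in> A \<Longrightarrow> y \<in> A \<Longrightarrow> x ** y \<in> A"
  using subalgebra by (simp_all add: subalgebra_def)

lemma sum_in: "(\<And>i. i \<in> I \<Longrightarrow> x i \<in> A) \<Longrightarrow> sum x I \<in> A"
  by (rule cmat.subspace_sum[OF subspace_A])

text \<open>The degenerate vectors \<open>?K\<close> form a left ideal of square zero, since
  \<open>x ** y = x ** (e ** e ** y)\<close> there. So some \<open>e ** a ** x\<close> is a nonzero
  multiple of \<open>e\<close>, and rescaling gives \<open>y\<close>.\<close>

lemma exists_dual: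
  assumes x: "x \<in> A" "x ** e = x" "x \<noteq> 0"
  obtains y where "y \<in> A" "e ** y = y" "y ** x = e"
proof -
  let ?K = "{x \<in> A. x ** e = x \<and> (\<forall>a\<in>A. e ** a ** x = 0)}"
  have "left_ideal A ?K"
    unfolding left_ideal_def
  proof (intro conjI ballI)
    show "cmat.subspace ?K"
      using subspace_A by (auto simp: cmat.subspace_def matrix_add_ldistrib matrix_add_rdistrib cmat_scale_mult)
    fix a x assume a: "a \<in> A" and x: "x \<in> ?K"
    have "e ** b ** (a ** x) = 0" if "b \<in> A" for b
    proof -
      have "e ** (b ** a) ** x = 0"
        using mult_in[OF that a] x by blast
      then show ?thesis
        by (simp add: matrix_mul_assoc)
    qed
    then show "a ** x \<in> ?K"
      using a x mult_in by (simp flip: matrix_mul_assoc)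
  qed auto
  moreover have "x ** y = 0" if "x \<in> ?K" "y \<in> ?K" for x y
  proof -
    have "x ** y = x ** (e ** e ** y)"
      using that by (simp add: e_idem matrix_mul_assoc)
    then show ?thesis
      using that e_in by simp
  qed
  ultimately have "?K \<subseteq> {0}"
    by (rule square_zero)
  then obtain a where a: "a \<in> A" "e ** a ** x \<noteq> 0"
    using x by blast
  obtain c where c: "e ** (a ** x) ** e = cmat_scale c e"
    using corner[OF mult_in[OF a(1) x(1)]] by blast
  then have c: "e ** a ** x = cmat_scale c e"
    by (metis matrix_mul_assoc x(2))
  show thesis
  proof
    show "cmat_scale (1 / c) (e ** a) \<in> A"
      using a(1) e_in mult_in by (simp add: cmat.subspace_scale[OF subspace_A])
    show "e ** cmat_scale (1 / c) (e ** a) = cmat_scale (1 / c) (e ** a)"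
      by (simp add: cmat_scale_mult matrix_mul_assoc e_idem)
    have "c \<noteq> 0"
      using a(2) c by auto
    then show "cmat_scale (1 / c) (e ** a) ** x = e"
      by (simp add: cmat_scale_mult c)
  qed
qed

text \<open>The left ideal \<open>A y\<close> has square zero, because
  \<open>y ** b ** y = y ** (b ** e) ** y\<close>; it contains \<open>y = e ** y\<close>.\<close>

lemma right_nondegenerate:
  assumes y: "y \<in> A" "e ** y = y" and z: "\<And>x. x \<in> A \<Longrightarrow> x ** e = x \<Longrightarrow> y ** x = 0"
  shows "y = 0"
proof -
  let ?N = "(\<lambda>a. a ** y) ` A"
  have "?N \<subseteq> {0}"
  proof (rule square_zero)
    show "left_ideal A ?N"
      using left_ideal_mult_right(1)[OF subalgebra_left_ideal subalgebra_left_ideal] subalgebra y(1)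
      by blast
    fix u v assume "u \<in> ?N" "v \<in> ?N"
    then obtain a b where ab: "a \<in> A" "b \<in> A" "u = a ** y" "v = b ** y"
      by blast
    have "y ** (b ** e) = 0"
      using ab e_in mult_in by (intro z) (simp_all add: e_idem flip: matrix_mul_assoc)
    then have "a ** (y ** (b ** e)) ** y = 0"
      by simp
    then show "u ** v = 0"
      by (metis ab(3,4) matrix_mul_assoc y(2))
  qed
  then show ?thesis
    using e_in y(2) by force
qed

definition dual_system :: "nat \<Rightarrow> (nat \<Rightarrow> complex^'n^'n) \<Rightarrow> (nat \<Rightarrow> complex^'n^'n) \<Rightarrow> bool" where
  "dual_system k x y \<longleftrightarrow>
    (\<forall>i<k. x i \<in> A \<and> x i ** e = x i \<and> y i \<in> A \<and> e ** y i = y i) \<and>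
    (\<forall>i<k. \<forall>j<k. y i ** x j = (if i = j then e else 0))"

text \<open>Left multiplication by \<open>y i\<close> kills every other \<open>x j\<close> but not
  \<open>x i\<close>, so the \<open>x i\<close> are independent over the reals.\<close>

lemma dual_system_bound:
  assumes "dual_system k x y"
  shows "k \<le> DIM(complex^'n^'n)"
proof -
  have yx: "y i ** x j = (if i = j then e else 0)" if "i < k" "j < k" for i j
    using assms that by (simp add: dual_system_def)
  have inj: "inj_on x {..<k}"
    by (rule inj_onI) (metis e_nz yx lessThan_iff)
  have "independent (x ` {..<k})"
    unfolding dependent_def
  proof safe
    fix i assume i: "i < k" and span: "x i \<in> span (x ` {..<k} - {x i})"
    have "subspace {u :: complex^'n^'n. y i ** u = 0}"
      by (intro cmat_subspace_imp_subspace)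
        (auto simp: cmat.subspace_def matrix_add_ldistrib cmat_scale_mult)
    moreover have "x ` {..<k} - {x i} \<subseteq> {u. y i ** u = 0}"
      using i by (auto simp: yx)
    ultimately have "y i ** x i = 0"
      using span span_minimal by blast
    then show False
      using yx i e_nz by simp
  qed
  then have "card (x ` {..<k}) \<le> DIM(complex^'n^'n)"
    using independent_bound by blast
  then show ?thesis
    by (simp add: card_image inj)
qed

text \<open>Take a system of maximal length. A vector \<open>u\<close> not fixed by \<open>f\<close>
  would extend it by a Gram-Schmidt step.\<close>

lemma exists_complete_dual_system:
  obtains k x y where "dual_system k x y"
    "\<And>u. u \<in> A \<Longrightarrow> u ** e = u \<Longrightarrow> (\<Sum>i<k. x i ** y i) ** u = u"
proof -
  let ?P = "\<lambda>k. \<exists>x y. dual_system k x y"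
  have "?P 0"
    by (simp add: dual_system_def)
  then obtain k where k: "?P k" and max: "\<And>l. ?P l \<Longrightarrow> l \<le> k"
    using Nat.ex_has_greatest_nat[of ?P 0 "DIM(complex^'n^'n)"] dual_system_bound by metis
  from k obtain x y where xy: "dual_system k x y"
    by blast
  define f where "f = (\<Sum>i<k. x i ** y i)"
  have x: "x i \<in> A" "x i ** e = x i" and y: "y i \<in> A" "e ** y i = y i" if "i < k" for i
    using xy that by (simp_all add: dual_system_def)
  have yx: "y i ** x j = (if i = j then e else 0)" if "i < k" "j < k" for i j
    using xy that by (simp add: dual_system_def)
  have fA: "f \<in> A"
    unfolding f_def using x y by (intro sum_in mult_in) auto
  have yf: "y i ** f = y i" if "i < k" for i
  proof -
    have "y i ** f = (\<Sum>j<k. if i = j then y i else 0)"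
      unfolding f_def matrix_sum_distrib
      by (intro sum.cong) (use that in \<open>auto simp: matrix_mul_assoc yx y\<close>)
    then show ?thesis
      using that by simp
  qed
  have fx: "f ** x j = x j" if "j < k" for j
  proof -
    have "f ** x j = (\<Sum>i<k. if i = j then x j else 0)"
      unfolding f_def matrix_sum_distrib
      by (intro sum.cong) (use that in \<open>auto simp: yx x simp flip: matrix_mul_assoc\<close>)
    then show ?thesis
      using that by simp
  qed
  have "f ** u = u" if u: "u \<in> A" "u ** e = u" for u
  proof (rule ccontr)
    assume "f ** u \<noteq> u"
    define x' where "x' = u - f ** u"
    have x': "x' \<in> A" "x' ** e = x'" "x' \<noteq> 0"
      using \<open>f ** u \<noteq> u\<close> u fA mult_in cmat.subspace_diff[OF subspace_A]
      by (auto simp: x'_def matrix_diff_distrib simp flip: matrix_mul_assoc)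
    then obtain z where z: "z \<in> A" "e ** z = z" "z ** x' = e"
      by (rule exists_dual)
    \<comment> \<open>The correction \<open>z ** f\<close> makes \<open>y'\<close> vanish on all
      \<open>x i\<close>, and \<open>f ** x' = 0\<close> preserves the value \<open>e\<close> on
      \<open>x'\<close>.\<close>
    define y' where "y' = z - z ** f"
    have y': "y' \<in> A" "e ** y' = y'"
      using z fA mult_in cmat.subspace_diff[OF subspace_A]
      by (auto simp: y'_def matrix_diff_distrib matrix_mul_assoc)
    have yx': "y i ** x' = 0" if "i < k" for i
      by (simp add: x'_def matrix_diff_distrib matrix_mul_assoc yf that)
    have y'x: "y' ** x i = 0" if "i < k" for i
      by (simp add: y'_def matrix_diff_distrib fx that flip: matrix_mul_assoc)
    have "f ** x' = 0"
      unfolding f_def matrix_sum_distrib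
      by (rule sum.neutral) (simp add: yx' flip: matrix_mul_assoc)
    then have y'x': "y' ** x' = e"
      by (simp add: y'_def matrix_diff_distrib z(3) flip: matrix_mul_assoc)
    have "dual_system (Suc k) (x(k := x')) (y(k := y'))"
      unfolding dual_system_def less_Suc_eq
      using x y yx x' y' yx' y'x y'x' by auto
    then show False
      using max by fastforce
  qed
  then show thesis
    using that xy unfolding f_def by blast
qed

text \<open>The outer product \<open>\<rho>\<close> of column \<open>j\<close> and row
  \<open>i\<close> of \<open>e\<close> squares to \<open>e $ i $ j\<close> times itself; a nonzero
  entry permits normalization.\<close>

lemma exists_rank_one_idempotent:
  obtains \<pi> where "\<pi> \<noteq> 0" "\<pi> ** \<pi> = \<pi>" "e ** \<pi> = \<pi>" "\<pi> ** e = \<pi>"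
    "\<And>m. \<exists>c. \<pi> ** m ** \<pi> = cmat_scale c \<pi>"
proof -
  obtain i j where ij: "e $ i $ j \<noteq> 0"
    using e_nz by (auto simp: vec_eq_iff)
  define \<rho> where "\<rho> = e ** elementary_matrix j i ** e"
  have \<rho>: "\<rho> $ k $ l = e $ k $ j * e $ i $ l" for k l
    by (simp add: \<rho>_def mult_elementary_mult)
  have sandwich: "\<rho> ** m ** \<rho> = cmat_scale ((e ** m ** e) $ i $ j) \<rho>" for m
  proof -
    have "\<rho> ** m ** \<rho> = (e ** elementary_matrix j i ** (e ** m ** e)) ** elementary_matrix j i ** e"
      by (simp add: \<rho>_def matrix_mul_assoc)
    then show ?thesis
      by (simp only: vec_eq_iff mult_elementary_mult cmat_scale_def \<rho> vec_lambda_beta) simp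
  qed
  have e\<rho>: "e ** \<rho> = \<rho>" "\<rho> ** e = \<rho>"
    by (simp_all add: \<rho>_def matrix_mul_assoc e_idem) (simp add: e_idem flip: matrix_mul_assoc)
  have \<rho>\<rho>: "\<rho> ** \<rho> = cmat_scale (e $ i $ j) \<rho>"
    using sandwich[of "mat 1"] by (simp add: e_idem)
  have "\<rho> $ i $ j \<noteq> 0"
    using ij by (simp add: \<rho>)
  then have "\<rho> \<noteq> 0"
    by auto
  define \<pi> where "\<pi> = cmat_scale (1 / e $ i $ j) \<rho>"
  show thesis
  proof
    show "\<pi> \<noteq> 0"
      using \<open>\<rho> \<noteq> 0\<close> ij by (simp add: \<pi>_def)
    show "\<pi> ** \<pi> = \<pi>" "e ** \<pi> = \<pi>" "\<pi> ** e = \<pi>"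
      using ij by (simp_all add: \<pi>_def cmat_scale_mult \<rho>\<rho> e\<rho>)
    show "\<exists>c. \<pi> ** m ** \<pi> = cmat_scale c \<pi>" for m
      using ij by (intro exI[of _ "(e ** m ** e) $ i $ j / e $ i $ j"]) (simp add: \<pi>_def cmat_scale_mult sandwich)
  qed
qed

lemma exists_commuting_idempotent:
  assumes "A \<noteq> UNIV"
  obtains p where "p ** p = p" "p \<noteq> 0" "p \<noteq> mat 1" "\<And>a. a \<in> A \<Longrightarrow> a ** p = p ** a"
proof -
  obtain k x y where xy: "dual_system k x y"
    and fu: "\<And>u. u \<in> A \<Longrightarrow> u ** e = u \<Longrightarrow> (\<Sum>i<k. x i ** y i) ** u = u"
    by (rule exists_complete_dual_system) blast
  have x: "x i \<in> A" "x i ** e = x i" and y: "y i \<in> A" "e ** y i = y i" if "i < k" for i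
    using xy that by (simp_all add: dual_system_def)
  have yx: "y i ** x j = (if i = j then e else 0)" if "i < k" "j < k" for i j
    using xy that by (simp add: dual_system_def)
  define f where "f = (\<Sum>i<k. x i ** y i)"
  have fA: "f \<in> A"
    unfolding f_def using x y by (intro sum_in mult_in) auto
  \<comment> \<open>\<open>f\<close> fixes \<open>A e\<close> from the left, so
    \<open>v - v ** f\<close> pairs to zero with \<open>A e\<close>, and nondegeneracy
    applies.\<close>
  have yf: "v ** f = v" if v: "v \<in> A" "e ** v = v" for v
  proof -
    have "v - v ** f = 0"
    proof (rule right_nondegenerate)
      show "v - v ** f \<in> A" "e ** (v - v ** f) = v - v ** f"
        using v fA mult_in cmat.subspace_diff[OF subspace_A]
        by (auto simp: matrix_diff_distrib matrix_mul_assoc)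
      show "(v - v ** f) ** u = 0" if "u \<in> A" "u ** e = u" for u
        using fu[OF that] by (simp add: matrix_diff_distrib f_def flip: matrix_mul_assoc)
    qed
    then show ?thesis
      by simp
  qed
  \<comment> \<open>For \<open>k = 0\<close> the empty sum would give
    \<open>e = 0 ** e = 0\<close>.\<close>
  have "k \<noteq> 0"
    using fu[OF e_in e_idem] e_nz by (intro notI) simp
  obtain \<pi> where \<pi>: "\<pi> \<noteq> 0" "\<pi> ** \<pi> = \<pi>" "e ** \<pi> = \<pi>" "\<pi> ** e = \<pi>"
    and \<pi>m: "\<And>m. \<exists>c. \<pi> ** m ** \<pi> = cmat_scale c \<pi>"
    by (rule exists_rank_one_idempotent) blast
  define p where "p = (\<Sum>i<k. x i ** \<pi> ** y i)"
  have px: "p ** x j = x j ** \<pi>" if "j < k" for j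
  proof -
    have "p ** x j = (\<Sum>i<k. if i = j then x j ** \<pi> else 0)"
      unfolding p_def matrix_sum_distrib
      by (intro sum.cong) (use that in \<open>auto simp: yx \<pi> simp flip: matrix_mul_assoc\<close>)
    then show ?thesis
      using that by simp
  qed
  have pp: "p ** p = p"
  proof -
    have "p ** p = (\<Sum>i<k. p ** (x i ** \<pi> ** y i))"
      by (subst (2) p_def) (simp add: matrix_sum_distrib)
    also have "\<dots> = p"
      unfolding p_def[symmetric] by (subst (2) p_def, intro sum.cong)
        (auto simp: px matrix_mul_assoc, simp add: \<pi> flip: matrix_mul_assoc)
    finally show ?thesis .
  qed
  have ypx: "y 0 ** p ** x 0 = \<pi>"
    using \<open>k \<noteq> 0\<close> by (simp add: px yx \<pi> flip: matrix_mul_assoc) (simp add: yx \<pi> matrix_mul_assoc)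
  have "p \<noteq> 0"
    using ypx \<pi>(1) by auto
  \<comment> \<open>Expanding \<open>a ** x i\<close> and \<open>y j ** a\<close> by
    \<open>f\<close> leaves the same coefficients \<open>y j ** a ** x i\<close>. These are
    multiples of \<open>e\<close>, so they commute with \<open>\<pi>\<close>.\<close>
  have comm: "a ** p = p ** a" if a: "a \<in> A" for a
  proof -
    have ax: "a ** x i = (\<Sum>j<k. x j ** (y j ** a ** x i))" if "i < k" for i
    proof -
      have "f ** (a ** x i) = a ** x i"
        unfolding f_def using x[OF that] a mult_in by (intro fu) (auto simp flip: matrix_mul_assoc)
      then show ?thesis
        by (simp add: f_def matrix_sum_distrib matrix_mul_assoc)
    qed
    have ya: "y j ** a = (\<Sum>i<k. (y j ** a ** x i) ** y i)" if "j < k" for j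
    proof -
      have "(y j ** a) ** f = y j ** a"
        using y[OF that] a mult_in by (intro yf) (auto simp: matrix_mul_assoc)
      then show ?thesis
        by (simp add: f_def matrix_sum_distrib matrix_mul_assoc)
    qed
    have central: "(y j ** a ** x i) ** \<pi> = \<pi> ** (y j ** a ** x i)" if ij: "i < k" "j < k" for i j
    proof -
      obtain c where "e ** (y j ** a ** x i) ** e = cmat_scale c e"
        using corner[OF mult_in[OF mult_in[OF y(1)[OF ij(2)] a] x(1)[OF ij(1)]]] by blast
      then have "y j ** a ** x i = cmat_scale c e"
        by (simp add: matrix_mul_assoc y(2)[OF ij(2)]) (simp add: x(2)[OF ij(1)] flip: matrix_mul_assoc)
      then show ?thesis
        by (simp add: cmat_scale_mult \<pi>)
    qed
    have "a ** p = (\<Sum>i<k. (a ** x i) ** \<pi> ** y i)"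
      by (simp add: p_def matrix_sum_distrib matrix_mul_assoc)
    also have "\<dots> = (\<Sum>i<k. \<Sum>j<k. x j ** ((y j ** a ** x i) ** \<pi>) ** y i)"
      by (intro sum.cong refl, subst ax) (simp_all add: matrix_sum_distrib matrix_mul_assoc)
    also have "\<dots> = (\<Sum>i<k. \<Sum>j<k. x j ** (\<pi> ** (y j ** a ** x i)) ** y i)"
      by (intro sum.cong refl) (simp add: central)
    also have "\<dots> = (\<Sum>j<k. \<Sum>i<k. x j ** \<pi> ** ((y j ** a ** x i) ** y i))"
      by (subst sum.swap) (simp add: matrix_mul_assoc)
    also have "\<dots> = (\<Sum>j<k. x j ** \<pi> ** (y j ** a))"
      by (intro sum.cong refl, subst (2) ya) (simp_all add: matrix_sum_distrib)
    also have "\<dots> = p ** a"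
      by (simp add: p_def matrix_sum_distrib matrix_mul_assoc)
    finally show ?thesis .
  qed
  \<comment> \<open>If \<open>p = 1\<close>, then \<open>\<pi> = y 0 ** x 0 = e\<close> and
    \<open>f = p = 1\<close>. Now \<open>e ** m ** e\<close> is a multiple of \<open>e\<close> for
    every matrix \<open>m\<close>, not only in \<open>A\<close>, so expanding
    \<open>m = f ** m ** f\<close> puts \<open>m\<close> into \<open>A\<close>.\<close>
  have "p \<noteq> mat 1"
  proof
    assume p1: "p = mat 1"
    have "\<pi> = e"
      using ypx \<open>k \<noteq> 0\<close> by (simp add: p1 yx)
    then have f1: "f = mat 1"
      using p1 x by (simp add: p_def f_def)
    have "m \<in> A" for m
    proof -
      have mid: "y i ** m ** x j \<in> A" if "i < k" "j < k" for i j
      proof -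
        obtain c where "e ** (y i ** m ** x j) ** e = cmat_scale c e"
          using \<pi>m \<open>\<pi> = e\<close> by blast
        then have "y i ** m ** x j = cmat_scale c e"
          by (simp add: matrix_mul_assoc y(2)[OF that(1)]) (simp add: x(2)[OF that(2)] flip: matrix_mul_assoc)
        then show ?thesis
          using e_in cmat.subspace_scale[OF subspace_A] by simp
      qed
      have "m = f ** m ** f"
        by (simp add: f1)
      also have "\<dots> = (\<Sum>i<k. \<Sum>j<k. x j ** (y j ** m ** x i) ** y i)"
        by (simp add: f_def matrix_sum_distrib matrix_mul_assoc)
      also have "\<dots> \<in> A"
        by (intro sum_in mult_in[OF mult_in[OF x(1) mid] y(1)]) auto
      finally show ?thesis .
    qed
    then show False
      using assms by blast
  qed
  then show thesis
    using that pp \<open>p \<noteq> 0\<close> comm by blast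
qed

end

theorem theorem3p3:
  "\<not> (\<exists>A1 A2 :: (complex^'n::finite^'n) set.
        subalgebra A1 \<and> subalgebra A2 \<and>
        A1 \<noteq> UNIV \<and> A2 \<noteq> UNIV \<and>
        semisimple A1 \<and> semisimple A2 \<and>
        UNIV = {x + y | x y. x \<in> A1 \<and> y \<in> A2})"
proof (intro notI, elim exE conjE)
  fix A1 A2 :: "(complex^'n::finite^'n) set"
  assume sub: "subalgebra A1" "subalgebra A2" and proper: "A1 \<noteq> UNIV" "A2 \<noteq> UNIV"
    and ss: "semisimple A1" "semisimple A2" and sum: "UNIV = {x + y | x y. x \<in> A1 \<and> y \<in> A2}"
  \<comment> \<open>A zero summand would force the other one to be everything.\<close>
  have nz: "A1 \<noteq> {0}" "A2 \<noteq> {0}"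
    using sum proper by auto
  obtain e1 where e1: "primitive_idempotent A1 e1"
    by (rule semisimple_imp_primitive_idempotent[OF sub(1) ss(1) nz(1)])
  interpret P1: primitive_idempotent A1 e1
    by (fact e1)
  obtain e2 where e2: "primitive_idempotent A2 e2"
    by (rule semisimple_imp_primitive_idempotent[OF sub(2) ss(2) nz(2)])
  interpret P2: primitive_idempotent A2 e2
    by (fact e2)
  obtain p where p: "p ** p = p" "p \<noteq> 0" "p \<noteq> mat 1" "\<And>a. a \<in> A1 \<Longrightarrow> a ** p = p ** a"
    by (rule P1.exists_commuting_idempotent[OF proper(1)]) blast
  obtain q where q: "q ** q = q" "q \<noteq> 0" "q \<noteq> mat 1" "\<And>a. a \<in> A2 \<Longrightarrow> a ** q = q ** a"
    by (rule P2.exists_commuting_idempotent[OF proper(2)]) blast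
  obtain z where z: "z \<noteq> 0" "p ** z + z ** p = z" "q ** z + z ** q = z"
    using common_off_diagonal p(1-3) q(1-3) by blast
  \<comment> \<open>\<open>z\<close> is trace-orthogonal to both centralizers, hence to
    \<open>A1 + A2\<close>.\<close>
  have "trace (m ** z) = 0" for m
  proof -
    obtain x y where "m = x + y" "x \<in> A1" "y \<in> A2"
      using sum by blast
    then show ?thesis
      using trace_centralizer_eq_0[OF p(1) p(4) z(2)] trace_centralizer_eq_0[OF q(1) q(4) z(3)]
      by (simp add: matrix_add_rdistrib trace_add)
  qed
  then show False
    using trace_form_nondegenerate z(1) by blast
qed

end
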